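(* Let $r$, $w$, and $t$ be positive integers with $w\le r$ and $t\ge r+w$. Then $$N((r,w),t)=bc(I_t(r,w)).$$
   Context: Write $[t]=\{1,\dots,t\}$. A set system $(X,\mathcal B)$ with $|X|=n$ and an indexed family of blocks $\mathcal B=\{B_1,\dots,B_t\}$ of subsets of $X$ is an $(r,w)-CFF(n,t)$ (cover-free family) if for all $L,M\subseteq[t]$ with $L\cap M=\varnothing$, $|L|=r$, $|M|=w$, we have $\bigcap_{l\in L}B_l\not\subseteq\bigcup_{m\in M}B_m$. $N((r,w),t)$ denotes the minimum $n$ for which an $(r,w)-CFF(n,t)$ exists. For $0<w\le r\le t$, the bi-intersection graph $I_t(r,w)$ is the bipartite graph with one part consisting of all $r$-subsets of $[t]$ and the other part of all $w$-subsets of $[t]$ (two disjoint parts, even when $r=w$), where a $w$-subset is adjacent to an $r$-subset if and only if their intersection is empty. A biclique is a bipartite graph with vertex set $(X,Y)$ in which every vertex of $X$ is adjacent to every vertex of $Y$ (empty graphs count as bicliques). A biclique cover of a graph $G$ is a collection of bicliques of $G$ (i.e. subgraphs of $G$ that are bicliques) such that each edge of $G$ is in at least one of them; $bc(G)$ is the minimum number of bicliques in a biclique cover of $G$. *)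

theory Defs
  imports Main
begin

definition is_cff :: "nat \<Rightarrow> nat \<Rightarrow> nat \<Rightarrow> nat \<Rightarrow> 'a set \<Rightarrow> (nat \<Rightarrow> 'a set) \<Rightarrow> bool" where
  "is_cff r w n t X B \<longleftrightarrow>
     finite X \<and> card X = n \<and> (\<forall>i\<in>{1..t}. B i \<subseteq> X) \<and>
     (\<forall>L M. L \<subseteq> {1..t} \<and> M \<subseteq> {1..t} \<and> L \<inter> M = {} \<and> card L = r \<and> card M = w \<longrightarrow>
        \<not> (\<Inter>l\<in>L. B l) \<subseteq> (\<Union>m\<in>M. B m))"

(* A finite ground set can always be relabelled by natural numbers, so it is no restriction
   to minimise over ground sets of type nat set only. *)
definition cff_number :: "nat \<Rightarrow> nat \<Rightarrow> nat \<Rightarrow> nat" where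
  "cff_number r w t = (LEAST n. \<exists>(X :: nat set) B. is_cff r w n t X B)"

(* An undirected simple graph is a pair of a vertex set and a set of two-element edges. *)
type_synonym 'v ugraph = "'v set \<times> 'v set set"

definition subgraph_of :: "'v ugraph \<Rightarrow> 'v ugraph \<Rightarrow> bool" where
  "subgraph_of H G \<longleftrightarrow> fst H \<subseteq> fst G \<and> snd H \<subseteq> snd G"

(* X or Y may be empty, so every edgeless graph is a biclique. *)
definition is_biclique :: "'v ugraph \<Rightarrow> bool" where
  "is_biclique H \<longleftrightarrow>
     (\<exists>X Y. X \<inter> Y = {} \<and> fst H = X \<union> Y \<and> snd H = {{x, y} | x y. x \<in> X \<and> y \<in> Y})"

definition is_biclique_cover :: "'v ugraph set \<Rightarrow> 'v ugraph \<Rightarrow> bool" where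
  "is_biclique_cover C G \<longleftrightarrow>
     (\<forall>H\<in>C. subgraph_of H G \<and> is_biclique H) \<and> (\<forall>e\<in>snd G. \<exists>H\<in>C. e \<in> snd H)"

definition bc :: "'v ugraph \<Rightarrow> nat" where
  "bc G = (LEAST k. \<exists>C. finite C \<and> card C = k \<and> is_biclique_cover C G)"

(* Inl tags the r-subsets and Inr the w-subsets, which keeps the two parts disjoint
   also when r = w. *)
definition bi_intersection_graph :: "nat \<Rightarrow> nat \<Rightarrow> nat \<Rightarrow> (nat set + nat set) ugraph" where
  "bi_intersection_graph t r w =
     (Inl ` {R. R \<subseteq> {1..t} \<and> card R = r} \<union> Inr ` {W. W \<subseteq> {1..t} \<and> card W = w},
      {{Inl R, Inr W} | R W.
         R \<subseteq> {1..t} \<and> card R = r \<and> W \<subseteq> {1..t} \<and> card W = w \<and> R \<inter> W = {}})"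

end

theory Submission
  imports Defs
begin

text \<open>
  A point \<open>x\<close> of a set system cuts \<open>[t]\<close> into the indices whose block contains \<open>x\<close> and those whose
  block avoids it. The cover-free condition for a disjoint pair \<open>(L, M)\<close> asks for a point that has
  all of \<open>L\<close> on the first side and all of \<open>M\<close> on the second. On the graph side, the \<open>r\<close>-sets
  within the first side together with the \<open>w\<close>-sets within the second side span a biclique of the
  bi-intersection graph, and the pair \<open>(L, M)\<close> is an edge of that graph. So "the point \<open>x\<close> handles
  the pair \<open>(L, M)\<close>" is the same as "the biclique of \<open>x\<close> covers the edge \<open>(L, M)\<close>", and
  points turn into bicliques (\<open>biclique_cover_from_cff\<close>).

  Conversely a biclique yields a point, contained in exactly those blocks whose index lies in some
  \<open>r\<close>-set incident with an edge of the biclique (\<open>cff_from_biclique_cover\<close>). Completeness of the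
  biclique keeps the union of these \<open>r\<close>-sets disjoint from every \<open>w\<close>-set incident with one of its
  edges.
\<close>

abbreviation edge :: "nat set \<Rightarrow> nat set \<Rightarrow> (nat set + nat set) set" where
  "edge R W \<equiv> {Inl R, Inr W}"

lemma edge_in_bi_intersection_graph_iff:
  "edge R W \<in> snd (bi_intersection_graph t r w) \<longleftrightarrow>
     R \<subseteq> {1..t} \<and> card R = r \<and> W \<subseteq> {1..t} \<and> card W = w \<and> R \<inter> W = {}"
  by (auto simp: bi_intersection_graph_def doubleton_eq_iff)

lemma bi_intersection_graph_edgeE:
  assumes "e \<in> snd (bi_intersection_graph t r w)"
  obtains R W where "e = edge R W"
    and "R \<subseteq> {1..t}" "card R = r" "W \<subseteq> {1..t}" "card W = w" "R \<inter> W = {}"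
  using assms by (auto simp: bi_intersection_graph_def)

definition biclique_of :: "nat set set \<Rightarrow> nat set set \<Rightarrow> (nat set + nat set) ugraph" where
  "biclique_of \<R> \<W> = (Inl ` \<R> \<union> Inr ` \<W>, {edge R W | R W. R \<in> \<R> \<and> W \<in> \<W>})"

lemma edge_in_biclique_of_iff:
  "edge R W \<in> snd (biclique_of \<R> \<W>) \<longleftrightarrow> R \<in> \<R> \<and> W \<in> \<W>"
  by (auto simp: biclique_of_def doubleton_eq_iff)

lemma is_biclique_biclique_of: "is_biclique (biclique_of \<R> \<W>)"
  unfolding is_biclique_def
  by (rule exI[of _ "Inl ` \<R>"], rule exI[of _ "Inr ` \<W>"]) (auto simp: biclique_of_def)

lemma subgraph_of_biclique_of:
  assumes "\<And>R. R \<in> \<R> \<Longrightarrow> R \<subseteq> {1..t} \<and> card R = r"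
    and "\<And>W. W \<in> \<W> \<Longrightarrow> W \<subseteq> {1..t} \<and> card W = w"
    and "\<And>R W. R \<in> \<R> \<Longrightarrow> W \<in> \<W> \<Longrightarrow> R \<inter> W = {}"
  shows "subgraph_of (biclique_of \<R> \<W>) (bi_intersection_graph t r w)"
proof -
  have "fst (biclique_of \<R> \<W>) \<subseteq> fst (bi_intersection_graph t r w)"
    using assms(1,2) by (auto simp: biclique_of_def bi_intersection_graph_def)
  moreover have "snd (biclique_of \<R> \<W>) \<subseteq> snd (bi_intersection_graph t r w)"
    using assms by (auto simp: biclique_of_def edge_in_bi_intersection_graph_iff)
  ultimately show ?thesis
    by (simp add: subgraph_of_def)
qed

text \<open>
  The two sides of an abstract biclique need not be matched with the two parts of the graph in a
  fixed order. However, they cannot be matched differently by two edges, since then two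
  \<open>r\<close>-sets would be adjacent.
\<close>

lemma biclique_exchange:
  assumes "is_biclique H" and "subgraph_of H (bi_intersection_graph t r w)"
    and RW: "edge R W \<in> snd H" and RW': "edge R' W' \<in> snd H"
  shows "edge R' W \<in> snd H"
proof -
  obtain X Y where H: "snd H = {{x, y} | x y. x \<in> X \<and> y \<in> Y}"
    using assms(1) by (auto simp: is_biclique_def)
  have no_left_edge: "{Inl R, Inl R'} \<notin> snd H"
    using assms(2) by (auto simp: subgraph_of_def bi_intersection_graph_def doubleton_eq_iff)
  have sides: "Inl P \<in> X \<and> Inr Q \<in> Y \<or> Inr Q \<in> X \<and> Inl P \<in> Y" if "edge P Q \<in> snd H" for P Q
    using that by (auto simp: H doubleton_eq_iff)
  have join: "{x, y} \<in> snd H" if "x \<in> X" "y \<in> Y" for x y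
    using that H by blast
  from sides[OF RW] sides[OF RW'] show ?thesis
    by (elim disjE conjE)
      (use join[of "Inl R'" "Inr W"] join[of "Inr W" "Inl R'"] join[of "Inl R" "Inl R'"]
         join[of "Inl R'" "Inl R"] no_left_edge in \<open>simp_all add: insert_commute\<close>)
qed

text \<open>
  Distinct points may give the same biclique, hence only an inequality for the size of the cover.
  Positivity of \<open>r\<close> ensures that a point witnessing the cover-free condition lies in some block,
  and therefore in \<open>X\<close>.
\<close>

lemma biclique_cover_from_cff:
  assumes cff: "is_cff r w n t X B" and "0 < r"
  shows "\<exists>C. finite C \<and> card C \<le> n \<and> is_biclique_cover C (bi_intersection_graph t r w)"
proof -
  define \<R> where "\<R> x = {R. R \<subseteq> {1..t} \<and> card R = r \<and> (\<forall>i\<in>R. x \<in> B i)}" for x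
  define \<W> where "\<W> x = {W. W \<subseteq> {1..t} \<and> card W = w \<and> (\<forall>i\<in>W. x \<notin> B i)}" for x
  define C where "C = (\<lambda>x. biclique_of (\<R> x) (\<W> x)) ` X"
  have X: "finite X" "card X = n" and B: "\<And>i. i \<in> {1..t} \<Longrightarrow> B i \<subseteq> X"
    and sep: "\<And>L M. L \<subseteq> {1..t} \<Longrightarrow> M \<subseteq> {1..t} \<Longrightarrow> L \<inter> M = {} \<Longrightarrow> card L = r \<Longrightarrow> card M = w
        \<Longrightarrow> \<not> (\<Inter>l\<in>L. B l) \<subseteq> (\<Union>m\<in>M. B m)"
    using cff by (auto simp: is_cff_def)
  have "finite C" "card C \<le> n"
    using X card_image_le[OF X(1)] by (auto simp: C_def)
  moreover have "is_biclique_cover C (bi_intersection_graph t r w)"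
    unfolding is_biclique_cover_def
  proof (intro conjI ballI)
    fix H assume "H \<in> C"
    then obtain x where H: "H = biclique_of (\<R> x) (\<W> x)"
      by (auto simp: C_def)
    show "is_biclique H"
      unfolding H by (rule is_biclique_biclique_of)
    show "subgraph_of H (bi_intersection_graph t r w)"
      unfolding H by (rule subgraph_of_biclique_of) (auto simp: \<R>_def \<W>_def)
  next
    fix e assume "e \<in> snd (bi_intersection_graph t r w)"
    then obtain L M where e: "e = edge L M"
      and L: "L \<subseteq> {1..t}" "card L = r" and M: "M \<subseteq> {1..t}" "card M = w" and "L \<inter> M = {}"
      by (rule bi_intersection_graph_edgeE)
    then have "\<not> (\<Inter>l\<in>L. B l) \<subseteq> (\<Union>m\<in>M. B m)"
      by (intro sep)
    then obtain x where "x \<in> (\<Inter>l\<in>L. B l)" "x \<notin> (\<Union>m\<in>M. B m)"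
      unfolding subset_iff by metis
    then have x: "\<And>l. l \<in> L \<Longrightarrow> x \<in> B l" "\<And>m. m \<in> M \<Longrightarrow> x \<notin> B m"
      by auto
    obtain l where "l \<in> L"
      using L(2) \<open>0 < r\<close> by fastforce
    then have "x \<in> X"
      using x(1) B L(1) by blast
    moreover have "e \<in> snd (biclique_of (\<R> x) (\<W> x))"
      using L M x by (simp add: e edge_in_biclique_of_iff \<R>_def \<W>_def)
    ultimately show "\<exists>H\<in>C. e \<in> snd H"
      by (auto simp: C_def)
  qed
  ultimately show ?thesis
    by blast
qed

lemma cff_from_biclique_cover:
  assumes "finite C" and cover: "is_biclique_cover C (bi_intersection_graph t r w)"
  shows "\<exists>(X :: nat set) B. is_cff r w (card C) t X B"
proof -
  let ?n = "card C"
  obtain f where f: "bij_betw f {0..<?n} C"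
    using ex_bij_betw_nat_finite[OF \<open>finite C\<close>] by blast
  define A where "A H = {i. \<exists>R W. edge R W \<in> snd H \<and> i \<in> R}" for H :: "(nat set + nat set) ugraph"
  define B where "B i = {x \<in> {0..<?n}. i \<in> A (f x)}" for i
  have "is_cff r w ?n t {0..<?n} B"
    unfolding is_cff_def
  proof (intro conjI allI impI)
    fix L M assume "L \<subseteq> {1..t} \<and> M \<subseteq> {1..t} \<and> L \<inter> M = {} \<and> card L = r \<and> card M = w"
    then have "edge L M \<in> snd (bi_intersection_graph t r w)"
      by (simp add: edge_in_bi_intersection_graph_iff)
    then obtain H where "H \<in> C" and LM: "edge L M \<in> snd H"
      using cover by (auto simp: is_biclique_cover_def)
    then have H: "is_biclique H" "subgraph_of H (bi_intersection_graph t r w)"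
      using cover by (auto simp: is_biclique_cover_def)
    obtain x where x: "x \<in> {0..<?n}" "f x = H"
      using bij_betw_imp_surj_on[OF f] \<open>H \<in> C\<close> by (metis imageE)
    have "x \<in> B l" if "l \<in> L" for l
      using that x LM by (auto simp: B_def A_def)
    moreover have "x \<notin> B m" if "m \<in> M" for m
    proof
      assume "x \<in> B m"
      then obtain R W where "edge R W \<in> snd H" "m \<in> R"
        using x by (auto simp: B_def A_def)
      then have "edge R M \<in> snd (bi_intersection_graph t r w)"
        using biclique_exchange[OF H LM] H(2) by (auto simp: subgraph_of_def)
      then show False
        using \<open>m \<in> R\<close> \<open>m \<in> M\<close> by (auto simp: edge_in_bi_intersection_graph_iff)
    qed
    ultimately show "\<not> (\<Inter>l\<in>L. B l) \<subseteq> (\<Union>m\<in>M. B m)"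
      by blast
  qed (auto simp: B_def)
  then show ?thesis
    by blast
qed

text \<open>
  Both invariants are least elements of sets of naturals, so they carry information only if these
  sets are nonempty. Covering every edge by itself shows this for bicliques, and
  \<open>cff_from_biclique_cover\<close> transfers it to cover-free families.
\<close>

lemma finite_biclique_cover_exists:
  "\<exists>C. finite C \<and> is_biclique_cover C (bi_intersection_graph t r w)"
proof -
  define E where "E = {(R, W). R \<subseteq> {1..t} \<and> card R = r \<and> W \<subseteq> {1..t} \<and> card W = w \<and> R \<inter> W = {}}"
  define C where "C = (\<lambda>(R, W). biclique_of {R} {W}) ` E"
  have "E \<subseteq> Pow {1..t} \<times> Pow {1..t}"
    by (auto simp: E_def)
  then have "finite C"
    unfolding C_def by (intro finite_imageI) (rule finite_subset, auto)
  moreover have "is_biclique_cover C (bi_intersection_graph t r w)"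
    unfolding is_biclique_cover_def
  proof (intro conjI ballI)
    fix H assume "H \<in> C"
    then obtain R W where RW: "(R, W) \<in> E" and H: "H = biclique_of {R} {W}"
      by (auto simp: C_def)
    show "is_biclique H"
      unfolding H by (rule is_biclique_biclique_of)
    show "subgraph_of H (bi_intersection_graph t r w)"
      unfolding H by (rule subgraph_of_biclique_of) (use RW in \<open>auto simp: E_def\<close>)
  next
    fix e assume "e \<in> snd (bi_intersection_graph t r w)"
    then obtain R W where e: "e = edge R W" and "(R, W) \<in> E"
      by (rule bi_intersection_graph_edgeE) (auto simp: E_def)
    then show "\<exists>H\<in>C. e \<in> snd H"
      by (intro bexI[of _ "biclique_of {R} {W}"])
        (auto simp: e edge_in_biclique_of_iff C_def)
  qed
  ultimately show ?thesis
    by blast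
qed

theorem theorem1:
  fixes r w t :: nat
  assumes "0 < r" and "0 < w" and "0 < t" and "w \<le> r" and "r + w \<le> t"
  shows "cff_number r w t = bc (bi_intersection_graph t r w)"
proof (rule antisym)
  let ?G = "bi_intersection_graph t r w"
  have "\<exists>k C. finite C \<and> card C = k \<and> is_biclique_cover C ?G"
    using finite_biclique_cover_exists by blast
  from LeastI_ex[OF this] obtain C where
    C: "finite C" "card C = bc ?G" "is_biclique_cover C ?G"
    unfolding bc_def by blast
  then have ex_cff: "\<exists>(X :: nat set) B. is_cff r w (bc ?G) t X B"
    using cff_from_biclique_cover by metis
  then show "cff_number r w t \<le> bc ?G"
    unfolding cff_number_def by (rule Least_le)
  have "\<exists>n. \<exists>(X :: nat set) B. is_cff r w n t X B"
    using ex_cff by blast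
  from LeastI_ex[OF this] obtain X :: "nat set" and B where
    "is_cff r w (cff_number r w t) t X B"
    unfolding cff_number_def by blast
  then obtain C' where
    C': "finite C'" "card C' \<le> cff_number r w t" "is_biclique_cover C' ?G"
    using biclique_cover_from_cff[OF _ \<open>0 < r\<close>] by metis
  then have "bc ?G \<le> card C'"
    unfolding bc_def by (intro Least_le) blast
  then show "bc ?G \<le> cff_number r w t"
    using C'(2) by linarith
qed

end
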